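(* Let $I \subset \mathbb{R}$ be a closed bounded interval and let $f : I \to I$ be a continuous map. If $f$ has a cycle of period $m$, then $f$ has a cycle of period $m'$ for every positive integer $m'$ such that $m \triangleright m'$, where $\triangleright$ denotes the Sharkovsky ordering of the positive integers.
   Context: For a positive integer $n$, a cycle of period $n$ of $f$ is a set $\{x, f(x), \ldots, f^{n-1}(x)\}$ with exactly $n$ distinct points and $f^n(x)=x$; equivalently $f^n(x)=x$ and $f^k(x)\neq x$ for $0<k<n$ (so "period" means least period). Here $f^k$ is the $k$-fold iterate of $f$. The Sharkovsky ordering is the strict total ordering $\triangleright$ of the positive integers that lists them in the following sequence ($a \triangleright b$ means that $a$ precedes $b$ in the list): first all odd numbers greater than $1$ in increasing order, then $2$ times each odd number greater than $1$ in increasing order, then $2^2$ times each odd number greater than $1$ in increasing order, and so on for each power of $2$; and after all of these, the powers of $2$ in decreasing order: $$3 \triangleright 5 \triangleright 7 \triangleright \cdots \triangleright 2\cdot 3 \triangleright 2\cdot 5 \triangleright 2 \cdot 7 \triangleright \cdots \triangleright 2^2\cdot 3 \triangleright 2^2\cdot 5 \triangleright \cdots \triangleright 2^3 \triangleright 2^2 \triangleright 2 \triangleright 1.$$ *)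

theory Defs
  imports "HOL-Analysis.Analysis"
begin

text \<open>
  \<open>I\<close> is the domain of the map: functions are total in HOL, so the starting point is required
  to lie in \<open>I\<close>. The condition \<open>card C = n\<close> says that the \<open>n\<close> listed points are distinct, so
  \<open>n\<close> is the least period.
\<close>

definition is_cycle :: "('a \<Rightarrow> 'a) \<Rightarrow> 'a set \<Rightarrow> nat \<Rightarrow> 'a set \<Rightarrow> bool" where
  "is_cycle f I n C \<longleftrightarrow>
     0 < n \<and> (\<exists>x\<in>I. C = (\<lambda>k. (f ^^ k) x) ` {..<n} \<and> card C = n \<and> (f ^^ n) x = x)"

text \<open>
  Every positive integer is uniquely \<open>2 ^ a * p\<close> with \<open>p\<close> odd. The three disjuncts compare two
  numbers that are not powers of two, a number that is not a power of two with one that is, and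
  two powers of two. The relation never holds if one of its arguments is \<open>0\<close>.
\<close>

definition sharkovsky :: "nat \<Rightarrow> nat \<Rightarrow> bool" (infix "\<triangleright>" 50) where
  "m \<triangleright> n \<longleftrightarrow>
     (\<exists>a p b q. m = 2 ^ a * p \<and> odd p \<and> n = 2 ^ b * q \<and> odd q \<and>
        (p > 1 \<and> q > 1 \<and> (a < b \<or> a = b \<and> p < q) \<or>
         p > 1 \<and> q = 1 \<or>
         p = 1 \<and> q = 1 \<and> b < a))"

end

theory Submission
  imports Defs
begin

text \<open>
  Following B.-S. Du, everything is read off the smallest point \<open>p\<close> of an orbit of period
  \<open>m \<ge> 3\<close>: there are \<open>p < v < b\<close> with \<open>f v = b\<close> and \<open>f b = p\<close>. A fixed point in \<open>[p, v]\<close> gives a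
  horseshoe and hence all periods. Otherwise the largest fixed point \<open>y\<close> of \<open>f\<^sup>2\<close> in \<open>[p, v]\<close> has
  period \<open>2\<close>, and \<open>f\<^sup>2\<close> moves the points of \<open>(y, v]\<close> to the left. If \<open>m\<close> is odd, comparing
  iterates at \<open>y\<close> and \<open>v\<close> yields period \<open>m + 2\<close>, and a horseshoe of \<open>f\<^sup>2\<close> around \<open>v\<close>, on which
  \<open>f\<close> takes values to the right of it, yields all even periods. The full ordering follows by applying
  these three facts to the iterates \<open>f ^^ (2 ^ i)\<close>.
\<close>

section \<open>Least periods and passage to powers of a map\<close>

text \<open>Recording all return times by divisibility, rather than only minimality of
  \<open>n\<close>, turns passage to a power of \<open>f\<close> into arithmetic.\<close>

definition least_period :: "('a \<Rightarrow> 'a) \<Rightarrow> nat \<Rightarrow> 'a \<Rightarrow> bool" where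
  "least_period f n x \<longleftrightarrow> 0 < n \<and> (\<forall>k. (f ^^ k) x = x \<longleftrightarrow> n dvd k)"

lemma funpow_mod_period:
  assumes "(f ^^ n) x = x"
  shows "(f ^^ (k mod n)) x = (f ^^ k) x"
proof -
  have mult: "(f ^^ (n * j)) x = x" for j
    by (induction j) (simp_all add: funpow_add assms)
  have "(f ^^ k) x = (f ^^ (k mod n + n * (k div n))) x"
    by simp
  also have "\<dots> = (f ^^ (k mod n)) x"
    by (simp only: funpow_add o_apply mult)
  finally show ?thesis by simp
qed

lemma least_periodI:
  assumes "0 < n" "(f ^^ n) x = x" "\<And>k. 0 < k \<Longrightarrow> k < n \<Longrightarrow> (f ^^ k) x \<noteq> x"
  shows "least_period f n x"
  unfolding least_period_def
proof (intro conjI allI)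
  fix k
  have "(f ^^ k) x = x \<longleftrightarrow> (f ^^ (k mod n)) x = x"
    by (simp add: funpow_mod_period assms(2))
  also have "\<dots> \<longleftrightarrow> k mod n = 0"
    using assms(3)[of "k mod n"] \<open>0 < n\<close> by (cases "k mod n = 0") auto
  finally show "(f ^^ k) x = x \<longleftrightarrow> n dvd k"
    by (simp add: dvd_eq_mod_eq_0)
qed (use assms in auto)

lemma least_periodD:
  assumes "least_period f n x"
  shows "0 < n" "(f ^^ n) x = x" "(f ^^ k) x = x \<longleftrightarrow> n dvd k"
  using assms by (auto simp: least_period_def)

lemma least_period_exists:
  assumes "0 < n" "(f ^^ n) x = x"
  obtains k where "least_period f k x" "k dvd n"
proof -
  let ?Q = "\<lambda>k. 0 < k \<and> (f ^^ k) x = x"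
  have "least_period f (LEAST k. ?Q k) x"
    using LeastI[of ?Q n] not_less_Least[of _ ?Q] assms by (intro least_periodI) auto
  with that assms show ?thesis
    by (metis least_periodD(3))
qed

lemma least_period_funpow:
  assumes "least_period f n x"
  shows "least_period f n ((f ^^ i) x)"
  unfolding least_period_def
proof (intro conjI allI)
  fix k
  have "(f ^^ k) ((f ^^ i) x) = (f ^^ i) x" if "n dvd k"
  proof -
    have "(f ^^ k) ((f ^^ i) x) = (f ^^ i) ((f ^^ k) x)"
      by (metis add.commute funpow_add o_apply)
    also have "(f ^^ k) x = x" using that least_periodD(3)[OF assms] by simp
    finally show ?thesis .
  qed
  moreover have "n dvd k" if "(f ^^ k) ((f ^^ i) x) = (f ^^ i) x"
  proof -
    \<comment> \<open>\<open>j\<close> further steps complete \<open>i\<close> to the multiple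
      \<open>i * n\<close> of the period and so lead back to \<open>x\<close>.\<close>
    define j where "j = i * n - i"
    have "i \<le> i * n" using least_periodD(1)[OF assms] by simp
    hence ji: "(f ^^ j) ((f ^^ i) x) = x"
      using least_periodD(3)[OF assms, of "j + i"] by (simp add: j_def flip: funpow_add[THEN fun_cong, unfolded o_apply])
    have "(f ^^ k) x = (f ^^ k) ((f ^^ j) ((f ^^ i) x))" using ji by simp
    also have "\<dots> = (f ^^ j) ((f ^^ k) ((f ^^ i) x))"
      by (metis add.commute funpow_add o_apply)
    also have "\<dots> = x" using that ji by simp
    finally show ?thesis using least_periodD(3)[OF assms] by simp
  qed
  ultimately show "(f ^^ k) ((f ^^ i) x) = (f ^^ i) x \<longleftrightarrow> n dvd k" by blast
qed (use least_periodD(1)[OF assms] in auto)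

lemma least_period_power:
  assumes "least_period f (s * n) x" "0 < s"
  shows "least_period (f ^^ s) n x"
  using assms by (auto simp: least_period_def funpow_mult)

text \<open>For the least period \<open>k\<close> under \<open>f\<close>,
  \<open>k dvd 2 ^ i * l\<close> holds iff \<open>e dvd l\<close>. Taking \<open>l = k\<close> and
  \<open>l = e\<close> squeezes \<open>k\<close> into the form \<open>2 ^ j * e\<close>. If
  \<open>e\<close> is even and \<open>j < i\<close>, then \<open>l = e div 2\<close> would also
  qualify, which is absurd. For odd \<open>e\<close>, factors of 2 can be lost.\<close>

lemma least_period_of_power_two:
  assumes "least_period (f ^^ (2 ^ i)) e x"
  shows "\<exists>j\<le>i. least_period f (2 ^ j * e) x \<and> (even e \<longrightarrow> j = i)"
proof -
  have e: "0 < e" "\<And>k. (f ^^ (2 ^ i * k)) x = x \<longleftrightarrow> e dvd k"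
    using assms by (auto simp: least_period_def funpow_mult)
  obtain k where k: "least_period f k x" "k dvd 2 ^ i * e"
    using least_period_exists[of "2 ^ i * e" f x] e by auto
  have ek: "k dvd 2 ^ i * l \<longleftrightarrow> e dvd l" for l
    using e(2)[of l] least_periodD(3)[OF k(1)] by simp
  have "e dvd k" using ek[of k] by simp
  then obtain c where c: "k = c * e" by (metis dvd_def mult.commute)
  with k(2) e(1) have "c dvd 2 ^ i" by simp
  then obtain j where j: "j \<le> i" "c = 2 ^ j"
    by (metis divides_primepow_nat two_is_prime_nat)
  have "j = i" if "even e"
  proof (rule ccontr)
    assume "j \<noteq> i"
    with j(1) obtain l where "i = j + Suc l"
      by (metis add_Suc_right le_neq_implies_less less_imp_Suc_add)
    moreover obtain h where "e = 2 * h" using \<open>even e\<close> by blast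
    ultimately have "k dvd 2 ^ i * h"
      by (simp add: c j(2) power_add mult_ac)
    hence "e dvd h" using ek by simp
    with \<open>e = 2 * h\<close> e(1) show False
      by (auto dest: dvd_imp_le)
  qed
  with j k(1) c show ?thesis by auto
qed

section \<open>Consequences of the intermediate value theorem\<close>

lemma continuous_on_funpow:
  fixes f :: "'a::topological_space \<Rightarrow> 'a"
  assumes "continuous_on UNIV f"
  shows "continuous_on S (f ^^ n)"
proof (rule continuous_on_subset[OF _ subset_UNIV], induction n)
  case (Suc n)
  show ?case
    unfolding funpow.simps
    by (rule continuous_on_compose[OF Suc continuous_on_subset[OF assms subset_UNIV]])
qed (auto simp: id_def)

lemma last_root:
  fixes h :: "real \<Rightarrow> real"
  assumes "continuous_on UNIV h" "x \<in> {l..r}" "h x = c"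
  obtains y where "y \<in> {x..r}" "h y = c" "\<And>t. y < t \<Longrightarrow> t \<le> r \<Longrightarrow> h t \<noteq> c"
proof -
  let ?S = "{x..r} \<inter> h -` {c}"
  have "compact ?S"
    using assms(1) by (intro compact_Int_closed closed_vimage compact_Icc closed_singleton)
  moreover have "x \<in> ?S" using assms by auto
  ultimately obtain y where y: "y \<in> ?S" "\<And>t. t \<in> ?S \<Longrightarrow> t \<le> y"
    using compact_attains_sup[of ?S] by blast
  have "h t \<noteq> c" if "y < t" "t \<le> r" for t
    using y(1) y(2)[of t] that by auto
  with y(1) show ?thesis by (intro that[of y]) auto
qed

lemma first_root:
  fixes h :: "real \<Rightarrow> real"
  assumes "continuous_on UNIV h" "x \<in> {l..r}" "h x = c"
  obtains y where "y \<in> {l..x}" "h y = c" "\<And>t. l \<le> t \<Longrightarrow> t < y \<Longrightarrow> h t \<noteq> c"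
proof -
  let ?S = "{l..x} \<inter> h -` {c}"
  have "compact ?S"
    using assms(1) by (intro compact_Int_closed closed_vimage compact_Icc closed_singleton)
  moreover have "x \<in> ?S" using assms by auto
  ultimately obtain y where "y \<in> ?S" "\<And>t. t \<in> ?S \<Longrightarrow> y \<le> t"
    using compact_attains_inf[of ?S] by blast
  thus ?thesis by (intro that[of y]) force+
qed

lemma interval_value:
  fixes h :: "real \<Rightarrow> real"
  assumes "continuous_on UNIV h" "l \<le> r" "h l \<le> c \<and> c \<le> h r \<or> h r \<le> c \<and> c \<le> h l"
  obtains x where "x \<in> {l..r}" "h x = c"
  using assms IVT'[of h l c r] IVT2'[of h r c l]
  by (meson atLeastAtMost_iff continuous_on_subset subset_UNIV)

lemma interval_fixpoint:
  fixes h :: "real \<Rightarrow> real"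
  assumes "continuous_on UNIV h" "l \<le> r" "h l \<le> l \<and> r \<le> h r \<or> h r \<le> r \<and> l \<le> h l"
  obtains x where "x \<in> {l..r}" "h x = x"
  using interval_value[of "\<lambda>x. h x - x" l r 0] assms
  by (force intro!: continuous_intros)

lemma interval_cover:
  fixes h :: "real \<Rightarrow> real"
  assumes "continuous_on UNIV h" "l \<le> r" "h l \<le> c \<and> d \<le> h r \<or> h r \<le> c \<and> d \<le> h l"
  shows "{c..d} \<subseteq> h ` {l..r}"
proof
  fix y assume "y \<in> {c..d}"
  with assms(3) have "h l \<le> y \<and> y \<le> h r \<or> h r \<le> y \<and> y \<le> h l" by auto
  from interval_value[OF assms(1,2) this] show "y \<in> h ` {l..r}" by blast
qed

text \<open>Take the last visit \<open>l\<close> to \<open>c\<close> and then the first visit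
  \<open>r\<close> to \<open>d\<close> after it. Leaving \<open>{c..d}\<close> in between would
  force another visit to \<open>c\<close> or \<open>d\<close>.\<close>

lemma increasing_crossing:
  fixes h :: "real \<Rightarrow> real"
  assumes h: "continuous_on UNIV h" and "x \<le> y" "h x = c" "h y = d" "c \<le> d"
  obtains l r where "l \<le> r" "{l..r} \<subseteq> {x..y}" "h ` {l..r} = {c..d}"
proof -
  obtain l where l: "l \<in> {x..y}" "h l = c" "\<And>t. l < t \<Longrightarrow> t \<le> y \<Longrightarrow> h t \<noteq> c"
    using last_root[OF h, of x x y c] assms by auto
  obtain r where r: "r \<in> {l..y}" "h r = d" "\<And>t. l \<le> t \<Longrightarrow> t < r \<Longrightarrow> h t \<noteq> d"
    using first_root[OF h, of y l y d] assms l by auto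
  have "h t \<in> {c..d}" if t: "t \<in> {l..r}" for t
  proof (rule ccontr)
    assume "h t \<notin> {c..d}"
    then consider "h t < c" | "h t > d" by force
    thus False
    proof cases
      case 1
      then obtain s where "s \<in> {t..r}" "h s = c"
        using interval_value[OF h, of t r c] t r(2) \<open>c \<le> d\<close> by auto
      moreover have "t \<noteq> l" using 1 l(2) by auto
      ultimately show False using l(3)[of s] t r(1) by auto
    next
      case 2
      then obtain s where "s \<in> {l..t}" "h s = d"
        using interval_value[OF h, of l t d] t l(2) \<open>c \<le> d\<close> by auto
      moreover have "t \<noteq> r" using 2 r(2) by auto
      ultimately show False using r(3)[of s] t by auto
    qed
  qed
  moreover have "{c..d} \<subseteq> h ` {l..r}"
    using l r by (intro interval_cover[OF h]) auto
  ultimately show ?thesis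
    using l r by (intro that[of l r]) auto
qed

lemma interval_image_subinterval:
  fixes h :: "real \<Rightarrow> real"
  assumes h: "continuous_on UNIV h" and "c \<le> d" and cover: "{c..d} \<subseteq> h ` {l..r}"
  obtains l' r' where "l' \<le> r'" "{l'..r'} \<subseteq> {l..r}" "h ` {l'..r'} = {c..d}"
proof -
  have "c \<in> h ` {l..r}" "d \<in> h ` {l..r}" using cover \<open>c \<le> d\<close> by auto
  then obtain x y where x: "x \<in> {l..r}" "h x = c" and y: "y \<in> {l..r}" "h y = d" by blast
  consider "x \<le> y" | "y \<le> x" by linarith
  thus ?thesis
  proof cases
    case 1
    obtain l' r' where l'r': "l' \<le> r'" "{l'..r'} \<subseteq> {x..y}" "h ` {l'..r'} = {c..d}"
      using increasing_crossing[OF h 1 x(2) y(2) \<open>c \<le> d\<close>] .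
    moreover have "{x..y} \<subseteq> {l..r}" using x y by auto
    ultimately show ?thesis by (intro that[of l' r']) auto
  next
    case 2
    \<comment> \<open>The preimages come in the opposite order; negating \<open>h\<close> restores
      the increasing case.\<close>
    have "continuous_on UNIV (\<lambda>t. - h t)" by (intro continuous_on_minus h)
    from increasing_crossing[OF this 2, of "-d" "-c"] x y \<open>c \<le> d\<close>
    obtain l' r' where l'r': "l' \<le> r'" "{l'..r'} \<subseteq> {y..x}" "(\<lambda>t. - h t) ` {l'..r'} = {-d..-c}"
      by auto
    have "h ` {l'..r'} = uminus ` (\<lambda>t. - h t) ` {l'..r'}" by (simp add: image_image)
    also have "\<dots> = {c..d}" unfolding l'r'(3) by simp
    finally have "h ` {l'..r'} = {c..d}" .
    moreover have "{y..x} \<subseteq> {l..r}" using x y by auto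
    ultimately show ?thesis using l'r' by (intro that[of l' r']) auto
  qed
qed

section \<open>Itineraries and horseshoes\<close>

text \<open>Pull back from the end: an interval that follows the shifted itinerary is the exact
  image of a subinterval of the first interval.\<close>

lemma itinerary_interval:
  fixes g :: "real \<Rightarrow> real" and lo hi :: "nat \<Rightarrow> real"
  assumes g: "continuous_on UNIV g"
    and "\<And>i. lo i \<le> hi i"
    and "\<And>i. i < n \<Longrightarrow> {lo (Suc i)..hi (Suc i)} \<subseteq> g ` {lo i..hi i}"
  shows "\<exists>l r. l \<le> r \<and> (\<forall>i\<le>n. (g ^^ i) ` {l..r} \<subseteq> {lo i..hi i}) \<and>
           (g ^^ n) ` {l..r} = {lo n..hi n}"
  using assms(2,3)
proof (induction n arbitrary: lo hi)
  case 0
  thus ?case by (intro exI[of _ "lo 0"] exI[of _ "hi 0"]) auto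
next
  case (Suc n)
  obtain l r where lr: "l \<le> r" "\<And>i. i \<le> n \<Longrightarrow> (g ^^ i) ` {l..r} \<subseteq> {lo (Suc i)..hi (Suc i)}"
      "(g ^^ n) ` {l..r} = {lo (Suc n)..hi (Suc n)}"
    using Suc.IH[of "\<lambda>i. lo (Suc i)" "\<lambda>i. hi (Suc i)"] Suc.prems by auto
  have "{l..r} \<subseteq> g ` {lo 0..hi 0}"
    using lr(2)[of 0] Suc.prems(2)[of 0] by (auto dest: subsetD)
  then obtain l' r' where l'r': "l' \<le> r'" "{l'..r'} \<subseteq> {lo 0..hi 0}" "g ` {l'..r'} = {l..r}"
    using interval_image_subinterval[OF g lr(1)] by blast
  have img: "(g ^^ Suc i) ` {l'..r'} = (g ^^ i) ` {l..r}" for i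
    unfolding funpow_Suc_right image_comp[symmetric] l'r'(3) ..
  have "(g ^^ i) ` {l'..r'} \<subseteq> {lo i..hi i}" if "i \<le> Suc n" for i
  proof (cases i)
    case 0
    thus ?thesis using l'r'(2) by simp
  next
    case (Suc j)
    with that lr(2)[of j] show ?thesis by (simp only: img)
  qed
  thus ?case
    using l'r'(1) lr(3) img[of n] by (intro exI[of _ l'] exI[of _ r']) simp
qed

text \<open>Write K and L for the two intervals. The itinerary L, K, ..., K, L gives a fixed point
  of \<open>g ^^ n\<close> in L. An earlier return would put it in K as well, hence at
  \<open>c\<close>, but then its next iterate could not lie in K.\<close>

lemma horseshoe:
  fixes g :: "real \<Rightarrow> real"
  assumes g: "continuous_on UNIV g" and "0 < n"
    and K: "k1 \<le> k2" "{k1..k2} \<subseteq> g ` {k1..k2}" "{l1..l2} \<subseteq> g ` {k1..k2}"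
    and L: "l1 \<le> l2" "{k1..k2} \<subseteq> g ` {l1..l2}" "{l1..l2} \<subseteq> g ` {l1..l2}"
    and KL: "{k1..k2} \<inter> {l1..l2} \<subseteq> {c}" "g c \<notin> {k1..k2}"
  obtains x where "least_period g n x" "\<And>i. (g ^^ i) x \<in> {k1..k2} \<union> {l1..l2}"
proof -
  define lo where "lo i = (if i = 0 \<or> i = n then l1 else k1)" for i
  define hi where "hi i = (if i = 0 \<or> i = n then l2 else k2)" for i
  have le: "lo i \<le> hi i" for i using K(1) L(1) by (auto simp: lo_def hi_def)
  have cov: "{lo (Suc i)..hi (Suc i)} \<subseteq> g ` {lo i..hi i}" for i
    using K L by (simp only: lo_def hi_def split: if_splits) blast
  obtain l r where lr: "l \<le> r" "\<And>i. i \<le> n \<Longrightarrow> (g ^^ i) ` {l..r} \<subseteq> {lo i..hi i}"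
      "(g ^^ n) ` {l..r} = {lo n..hi n}"
    using itinerary_interval[OF g, of lo hi n] le cov by blast
  have "{l..r} \<subseteq> (g ^^ n) ` {l..r}"
    using lr(2)[of 0] lr(3) by (simp add: lo_def hi_def)
  with lr(1) have "l \<in> (g ^^ n) ` {l..r}" "r \<in> (g ^^ n) ` {l..r}" by auto
  \<comment> \<open>The iterate moves \<open>s\<close> weakly left and \<open>t\<close> weakly
    right, so it has a fixed point between them.\<close>
  then obtain s t where st: "s \<in> {l..r}" "(g ^^ n) s = l" "t \<in> {l..r}" "(g ^^ n) t = r" by force
  have "\<exists>x\<in>{l..r}. (g ^^ n) x = x"
  proof (cases "s \<le> t")
    case True
    then obtain x where "x \<in> {s..t}" "(g ^^ n) x = x"
      using interval_fixpoint[OF continuous_on_funpow[OF g, of _ n], of s t] st by auto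
    with st show ?thesis by auto
  next
    case False
    then obtain x where "x \<in> {t..s}" "(g ^^ n) x = x"
      using interval_fixpoint[OF continuous_on_funpow[OF g, of _ n], of t s] st by auto
    with st show ?thesis by auto
  qed
  then obtain x where x: "x \<in> {l..r}" "(g ^^ n) x = x" by blast
  have orb: "(g ^^ i) x \<in> {lo i..hi i}" if "i \<le> n" for i
    using lr(2)[OF that] x(1) by blast
  have xL: "x \<in> {l1..l2}" using orb[of 0] by (simp add: lo_def hi_def)
  have "(g ^^ k) x \<noteq> x" if k: "0 < k" "k < n" for k
  proof
    assume "(g ^^ k) x = x"
    moreover have "(g ^^ k) x \<in> {k1..k2}" using orb[of k] k by (simp add: lo_def hi_def)
    ultimately have "x = c" using KL(1) xL by auto
    moreover have "g x \<in> {k1..k2}" using orb[of 1] k by (simp add: lo_def hi_def)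
    ultimately show False using KL(2) by simp
  qed
  hence "least_period g n x"
    using x(2) \<open>0 < n\<close> by (intro least_periodI)
  moreover have "(g ^^ i) x \<in> {k1..k2} \<union> {l1..l2}" for i
  proof -
    have "i mod n \<le> n" using \<open>0 < n\<close> by (simp add: less_imp_le)
    from orb[OF this] have "(g ^^ (i mod n)) x \<in> {k1..k2} \<union> {l1..l2}"
      by (auto simp: lo_def hi_def split: if_splits)
    thus ?thesis by (simp add: funpow_mod_period x(2))
  qed
  ultimately show ?thesis using that by blast
qed

text \<open>Each half of \<open>{l..r}\<close> is mapped over the whole. The common point
  \<open>c\<close> is sent beyond one end, hence outside the opposite half, and that half takes the
  role of the interval visited at intermediate times.\<close>

lemma horseshoe_cases:
  fixes g :: "real \<Rightarrow> real"
  assumes g: "continuous_on UNIV g" and n: "0 < n" and lcr: "l < c" "c < r"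
    and v: "g l \<le> l \<and> r \<le> g c \<and> g r \<le> l \<or> r \<le> g l \<and> g c \<le> l \<and> r \<le> g r"
  obtains x where "least_period g n x" "\<And>i. (g ^^ i) x \<in> {l..r}"
proof -
  have cov: "{l..r} \<subseteq> g ` {l..c}" "{l..r} \<subseteq> g ` {c..r}"
    by (rule interval_cover[OF g]; use v lcr in auto)+
  have sub: "{l..c} \<subseteq> {l..r}" "{c..r} \<subseteq> {l..r}" using lcr by auto
  note covers = subset_trans[OF sub(1) cov(1)] subset_trans[OF sub(2) cov(1)]
    subset_trans[OF sub(1) cov(2)] subset_trans[OF sub(2) cov(2)]
  have le: "l \<le> c" "c \<le> r" and int: "{l..c} \<inter> {c..r} \<subseteq> {c}" "{c..r} \<inter> {l..c} \<subseteq> {c}"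
    using lcr by auto
  show ?thesis
  proof (cases "r \<le> g c")
    case True
    with lcr have "g c \<notin> {l..c}" by auto
    from horseshoe[OF g n le(1) covers(1,2) le(2) covers(3,4) int(1) this]
    obtain x where "least_period g n x" "\<And>i. (g ^^ i) x \<in> {l..c} \<union> {c..r}" by blast
    with sub show ?thesis by (intro that[of x]) blast+
  next
    case False
    with lcr v have "g c \<notin> {c..r}" by auto
    from horseshoe[OF g n le(2) covers(4,3) le(1) covers(2,1) int(2) this]
    obtain x where "least_period g n x" "\<And>i. (g ^^ i) x \<in> {c..r} \<union> {l..c}" by blast
    with sub show ?thesis by (intro that[of x]) blast+
  qed
qed

section \<open>The smallest point of an orbit and the resulting dichotomy\<close>

text \<open>\<open>b\<close> is the predecessor of the minimum \<open>p\<close> on the orbit. The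
  orbit climbs from \<open>p\<close> to \<open>b\<close>, so some orbit point below \<open>b\<close>
  is sent to \<open>b\<close> or above, while \<open>f b = p < b\<close>; the intermediate value
  theorem then supplies \<open>v\<close>.\<close>

lemma orbit_configuration:
  fixes f :: "real \<Rightarrow> real"
  assumes f: "continuous_on UNIV f" and x: "least_period f m x" and m: "3 \<le> m"
  obtains p v b where "p < v" "v < b" "f v = b" "f b = p" "least_period f m p"
    "(f ^^ (m - 1)) p = b" "\<And>i. p \<le> (f ^^ i) p"
proof -
  let ?P = "(\<lambda>i. (f ^^ i) x) ` {..<m}"
  have inP: "(f ^^ i) x \<in> ?P" for i
    using funpow_mod_period[OF least_periodD(2)[OF x], of i] m
    by (intro image_eqI[of _ _ "i mod m"]) auto
  have P: "finite ?P" "?P \<noteq> {}" using inP[of 0] by auto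
  define p where "p = Min ?P"
  have "p \<in> ?P" unfolding p_def by (rule Min_in[OF P])
  then obtain j where j: "p = (f ^^ j) x" by blast
  have p: "least_period f m p" unfolding j by (rule least_period_funpow[OF x])
  have p_le: "p \<le> (f ^^ i) p" for i
  proof -
    have "(f ^^ i) p = (f ^^ (i + j)) x" by (simp add: j funpow_add)
    with inP[of "i + j"] Min_le[OF P(1)] show ?thesis by (simp add: p_def)
  qed
  define b where "b = (f ^^ (m - 1)) p"
  have "m = Suc (m - 1)" using m by simp
  hence fb: "f b = p"
    using least_periodD(2)[OF p] unfolding b_def by (metis funpow.simps(2) o_apply)
  have ne: "(f ^^ i) p \<noteq> p" if "0 < i" "i < m" for i
    using least_periodD(3)[OF p, of i] that by (auto dest: dvd_imp_le)
  have "b \<noteq> p" using ne[of "m - 1"] m by (simp add: b_def)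
  with p_le[of "m - 1"] have pb: "p < b" by (simp add: b_def)
  have "\<exists>i. (f ^^ i) p < b \<and> b \<le> f ((f ^^ i) p)"
  proof (rule ccontr)
    assume "\<not> ?thesis"
    hence step: "f ((f ^^ i) p) < b" if "(f ^^ i) p < b" for i using that by force
    have "(f ^^ i) p < b" for i by (induction i) (use pb step in auto)
    from this[of "m - 1"] show False by (simp add: b_def)
  qed
  then obtain i where i: "(f ^^ i) p < b" "b \<le> f ((f ^^ i) p)" by blast
  obtain v where v: "v \<in> {(f ^^ i) p..b}" "f v = b"
    using interval_value[OF f, of "(f ^^ i) p" b b] i fb pb by auto
  have "v \<noteq> b" using v fb pb by auto
  with v have "v < b" by simp
  \<comment> \<open>Otherwise \<open>f (f p) = p\<close>, against \<open>m \<ge> 3\<close>.\<close>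
  have "v \<noteq> p" using v(2) fb ne[of 2] m by (auto simp: eval_nat_numeral)
  with v p_le[of i] have "p < v" by simp
  with \<open>v < b\<close> v fb p p_le show ?thesis by (intro that[of p v b]) (auto simp: b_def)
qed

text \<open>The case without a fixed point of \<open>f\<close> in \<open>{p..v}\<close>. Both
  \<open>above\<close> and \<open>below\<close> state absence of fixed points through a sign,
  determined at \<open>v\<close> by \<open>f v = b > v\<close> and
  \<open>f (f v) = p < v\<close>.\<close>

locale orbit_without_fixpoint =
  fixes f :: "real \<Rightarrow> real" and p v b y :: real and m :: nat
  assumes cont: "continuous_on UNIV f"
    and order: "p < y" "y < v" "v < b"
    and fv: "f v = b" and fb: "f b = p"
    and per: "least_period f m p" and last: "(f ^^ (m - 1)) p = b"
    and min: "\<And>i. p \<le> (f ^^ i) p"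
    and above: "\<And>t. p \<le> t \<Longrightarrow> t \<le> v \<Longrightarrow> t < f t"
    and ffy: "f (f y) = y"
    and below: "\<And>t. y < t \<Longrightarrow> t \<le> v \<Longrightarrow> f (f t) < t"

lemma continuous_on_twice:
  fixes f :: "real \<Rightarrow> real"
  assumes "continuous_on UNIV f"
  shows "continuous_on UNIV (\<lambda>x. f (f x))"
  using continuous_on_funpow[OF assms, of UNIV 2] by (simp add: eval_nat_numeral o_def)

lemma orbit_cases:
  fixes f :: "real \<Rightarrow> real"
  assumes f: "continuous_on UNIV f" and x: "least_period f m x" and m: "3 \<le> m"
  shows "(\<forall>n>0. \<exists>x. least_period f n x) \<or> (\<exists>p v b y. orbit_without_fixpoint f p v b y m)"
proof -
  obtain p v b where c: "p < v" "v < b" "f v = b" "f b = p" "least_period f m p"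
    "(f ^^ (m - 1)) p = b" "\<And>i. p \<le> (f ^^ i) p"
    using orbit_configuration[OF assms] by metis
  show ?thesis
  proof (cases "\<exists>t\<in>{p..v}. f t = t")
    case True
    then obtain t where t: "t \<in> {p..v}" "f t = t" by blast
    with c have "t \<noteq> v" by auto
    with t have tv: "t < v" by simp
    \<comment> \<open>With \<open>f t = t\<close>, \<open>f v = b\<close> and
      \<open>f b = p\<close>, the points \<open>t < v < b\<close> span a horseshoe of
      \<open>f\<close>.\<close>
    have "f t \<le> t \<and> b \<le> f v \<and> f b \<le> t" using t c by simp
    hence "\<exists>x. least_period f n x" if n: "0 < n" for n
      using horseshoe_cases[OF f n tv c(2)] by blast
    thus ?thesis by blast
  next
    case False
    have above: "t < f t" if "p \<le> t" "t \<le> v" for t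
    proof (rule ccontr)
      assume "\<not> t < f t"
      with c(2,3) have "f t \<le> t \<and> v \<le> f v" by simp
      with interval_fixpoint[OF f that(2)] obtain s where "s \<in> {t..v}" "f s = s" by blast
      with that False show False by auto
    qed
    let ?h = "\<lambda>t. f (f t) - t"
    have ff: "continuous_on UNIV (\<lambda>x. f (f x))" by (rule continuous_on_twice[OF f])
    have h: "continuous_on UNIV ?h" by (intro continuous_on_diff ff continuous_on_id)
    \<comment> \<open>\<open>f (f t) - t\<close> is nonnegative at \<open>p\<close> by minimality
      and negative at \<open>v\<close>, so it has a root.\<close>
    have "p \<le> f (f p)" using c(7)[of 2] by (simp add: eval_nat_numeral)
    then obtain s where s: "s \<in> {p..v}" "?h s = 0"
      using interval_value[OF h, of p v 0] c(1,3,4) by auto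
    from last_root[OF h s] obtain y
      where "y \<in> {s..v}" "?h y = 0" and y_last: "\<And>t. y < t \<Longrightarrow> t \<le> v \<Longrightarrow> ?h t \<noteq> 0"
      by blast
    with s(1) have y: "y \<in> {p..v}" "f (f y) = y" by auto
    have "y \<noteq> v" using y c by auto
    have "f (f p) \<noteq> p"
      using least_periodD(3)[OF c(5), of 2] m by (auto simp: eval_nat_numeral dest!: dvd_imp_le)
    with y have "y \<noteq> p" by auto
    have "f (f t) < t" if "y < t" "t \<le> v" for t
    proof (rule ccontr)
      assume "\<not> f (f t) < t"
      with c(1,3,4) have "f (f v) \<le> v \<and> t \<le> f (f t)" by simp
      with interval_fixpoint[OF ff that(2)] obtain s where "s \<in> {t..v}" "f (f s) = s" by blast
      with that y_last[of s] show False by auto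
    qed
    hence "orbit_without_fixpoint f p v b y m"
      using f c y \<open>y \<noteq> v\<close> \<open>y \<noteq> p\<close> above by unfold_locales auto
    thus ?thesis by blast
  qed
qed

section \<open>New periods in the absence of a fixed point\<close>

context orbit_without_fixpoint
begin

lemma above_y: "y < f y"
  using above[of y] order by simp

lemma least_period_y: "least_period f 2 y"
proof (rule least_periodI)
  fix k :: nat assume "0 < k" "k < 2"
  hence "k = 1" by simp
  thus "(f ^^ k) y \<noteq> y" using above_y by simp
qed (use ffy in \<open>auto simp: eval_nat_numeral\<close>)

lemma odd_funpow_y: "odd k \<Longrightarrow> (f ^^ k) y = f y"
  using funpow_mod_period[OF least_periodD(2)[OF least_period_y], of k]
  by (simp add: odd_iff_mod_2_eq_one)

text \<open>\<open>f ^^ (k + 2)\<close> sends \<open>y\<close> to \<open>f y > y\<close>, since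
  \<open>k\<close> is odd, but \<open>t\<close> to \<open>f (f t) < t\<close>.\<close>

lemma fixpoint_left:
  assumes "odd k" "t \<in> {y<..<v}" "(f ^^ k) t = t"
  shows "\<exists>s\<in>{y<..<t}. (f ^^ (k + 2)) s = s"
proof -
  have c: "continuous_on UNIV (f ^^ (k + 2))" by (rule continuous_on_funpow[OF cont])
  have y: "(f ^^ (k + 2)) y > y" using above_y odd_funpow_y[of "k + 2"] assms by simp
  have "(f ^^ (2 + k)) t = f (f ((f ^^ k) t))" by (simp add: eval_nat_numeral)
  hence t: "(f ^^ (k + 2)) t < t"
    using assms below[of t] by (simp add: add.commute)
  obtain s where s: "s \<in> {y..t}" "(f ^^ (k + 2)) s = s"
    using interval_fixpoint[OF c, of y t] y t assms by force
  with y t show ?thesis by (intro bexI[of _ s]) (auto simp: order.strict_iff_order)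
qed

text \<open>A fixed point of \<open>f ^^ (m + 2)\<close> closest to \<open>y\<close> has no smaller period: a smaller odd period
  would, by adding \<open>2\<close> repeatedly, produce a fixed point still closer to \<open>y\<close>.\<close>

lemma period_add_2:
  assumes "odd m"
  shows "\<exists>x. least_period f (m + 2) x"
proof -
  let ?h = "\<lambda>t. (f ^^ (m + 2)) t - t"
  have h: "continuous_on UNIV ?h"
    by (intro continuous_on_diff continuous_on_funpow[OF cont] continuous_on_id)
  have y: "?h y > 0" using above_y odd_funpow_y[of "m + 2"] assms by simp
  \<comment> \<open>Two steps lead from \<open>v\<close> to \<open>p\<close>, and the other
    \<open>m\<close> steps return to \<open>p\<close>.\<close>
  have "(f ^^ (m + 2)) v = (f ^^ m) (f (f v))"
    by (simp only: funpow_add o_apply) (simp add: eval_nat_numeral)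
  also have "\<dots> = p" using fv fb least_periodD(2)[OF per] by simp
  finally have v: "?h v < 0" using order by simp
  obtain s where "s \<in> {y..v}" "?h s = 0"
    using interval_value[OF h, of y v 0] y v order by auto
  then obtain x where x: "x \<in> {y..s}" "?h x = 0" "\<And>t. y \<le> t \<Longrightarrow> t < x \<Longrightarrow> ?h t \<noteq> 0"
    using first_root[OF h, of s y v 0] by metis
  with \<open>s \<in> {y..v}\<close> have "x \<in> {y..v}" by auto
  moreover have "x \<noteq> y" "x \<noteq> v" using y v x(2) by auto
  ultimately have x_in: "x \<in> {y<..<v}" by auto
  obtain k where k: "least_period f k x" "k dvd m + 2"
    using least_period_exists[of "m + 2" f x] x(2) by auto
  have "odd k" using k(2) assms by (metis dvd_trans even_add even_numeral)
  have "k = m + 2"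
  proof (rule ccontr)
    assume "k \<noteq> m + 2"
    with dvd_imp_le[OF k(2)] have less: "k < m + 2" by simp
    \<comment> \<open>The count starts at \<open>Suc i\<close> because only after one addition of 2
      is the fixed point strictly left of \<open>x\<close>.\<close>
    have *: "\<exists>t\<in>{y<..<x}. (f ^^ (k + 2 * Suc i)) t = t" for i
    proof (induction i)
      case 0
      thus ?case using fixpoint_left[OF \<open>odd k\<close> x_in] least_periodD(2)[OF k(1)] by simp
    next
      case (Suc i)
      then obtain t where t: "t \<in> {y<..<x}" "(f ^^ (k + 2 * Suc i)) t = t" by blast
      moreover have "k + 2 * Suc (Suc i) = (k + 2 * Suc i) + 2" by simp
      ultimately show ?case
        using fixpoint_left[of "k + 2 * Suc i" t] \<open>odd k\<close> x_in
        by (metis dvd_triv_left even_add greaterThanLessThan_iff less_trans)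
    qed
    have "even (m + 2 - k)" using \<open>odd k\<close> assms less by simp
    then obtain j where "m + 2 - k = 2 * j" by blast
    with less have "m + 2 = k + 2 * Suc (j - 1)" by simp
    then obtain i where "m + 2 = k + 2 * Suc i" by blast
    with *[of i] obtain t where "t \<in> {y<..<x}" "(f ^^ (m + 2)) t = t" by auto
    with x(3)[of t] show False by simp
  qed
  with k(1) show ?thesis by blast
qed

lemma even_periods:
  assumes "odd m" "3 \<le> m" "0 < n"
  shows "\<exists>x. least_period f (2 * n) x"
proof (cases "n = 1")
  case True
  with least_period_y show ?thesis by auto
next
  case False
  text \<open>In the sequel \<open>z\<close> is the first fixed point of \<open>f\<^sup>2\<close> to the right of \<open>v\<close>, and \<open>d\<close> the last point
    left of \<open>y\<close> that \<open>f\<^sup>2\<close> maps to \<open>z\<close>; since \<open>f > z\<close> inside \<open>[d, z]\<close>, an \<open>f\<^sup>2\<close>-orbit of period \<open>n > 1\<close> in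
    \<open>[d, z]\<close> has period \<open>2 * n\<close> under \<open>f\<close>.\<close>
  let ?g = "\<lambda>x. f (f x)"
  let ?h = "\<lambda>t. f (f t) - t"
  have g: "continuous_on UNIV ?g" by (rule continuous_on_twice[OF cont])
  have h: "continuous_on UNIV ?h" by (intro continuous_on_diff g continuous_on_id)
  obtain c where c: "c \<in> {v..b}" "f c = c"
    using interval_fixpoint[OF cont, of v b] order fv fb by auto
  have "continuous_on UNIV (\<lambda>t. f t - t)" by (intro continuous_on_diff cont continuous_on_id)
  from first_root[OF this, of c v b 0] c obtain z1
    where z1: "z1 \<in> {v..c}" "f z1 = z1" "\<And>t. v \<le> t \<Longrightarrow> t < z1 \<Longrightarrow> f t \<noteq> t"
    by auto
  from first_root[OF h, of z1 v z1 0] z1(1,2) obtain z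
    where z: "z \<in> {v..z1}" "f (f z) = z" "\<And>t. v \<le> t \<Longrightarrow> t < z \<Longrightarrow> f (f t) \<noteq> t"
    by auto
  have "z \<noteq> v" using z(2) fv fb order by auto
  with z(1) have vz: "v < z" by simp
  \<comment> \<open>\<open>f\<close> lies above the diagonal at \<open>v\<close> and has no fixed
    point in \<open>[v, z)\<close>, as \<open>z \<le> z1\<close>.\<close>
  have "z \<le> f z"
  proof (rule ccontr)
    assume "\<not> z \<le> f z"
    then obtain s where s: "s \<in> {v..z}" "f s = s"
      using interval_fixpoint[OF cont, of v z] vz fv order by force
    with z1(3)[of s] z(1) have "s = z" by force
    with s \<open>\<not> z \<le> f z\<close> show False by simp
  qed
  have "z \<noteq> b" using \<open>z \<le> f z\<close> fb order by auto
  with z(1) z1(1) c(1) have zb: "z < b" by auto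
  have g_less: "?g t < t" if "y < t" "t < z" for t
  proof (cases "t \<le> v")
    case False
    show ?thesis
    proof (rule ccontr)
      assume "\<not> ?g t < t"
      then obtain s where "s \<in> {v..t}" "?g s = s"
        using interval_fixpoint[OF g, of v t] False fv fb order by force
      with z(3)[of s] that show False by auto
    qed
  qed (use below that in simp)
  have f_ne: "f t \<noteq> z" if "?g t < z" for t
    using that \<open>z \<le> f z\<close> by auto
  \<comment> \<open>Here oddness of \<open>m\<close> enters: \<open>b\<close> is an even iterate of
    \<open>p\<close>, so iterating \<open>?g\<close> from \<open>p < z\<close> reaches
    \<open>b > z\<close> and must pass \<open>z\<close> in some step.\<close>
  have "\<exists>i. (f ^^ i) p < z \<and> z \<le> ?g ((f ^^ i) p)"
  proof (rule ccontr)
    assume "\<not> ?thesis"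
    hence step: "?g ((f ^^ i) p) < z" if "(f ^^ i) p < z" for i using that by force
    have "(f ^^ (2 * i)) p < z" for i
      by (induction i) (use order vz step in auto)
    moreover have "even (m - 1)" using assms by simp
    ultimately have "b < z" using last by (metis evenE)
    with zb show False by simp
  qed
  then obtain i where i: "(f ^^ i) p < z" "z \<le> ?g ((f ^^ i) p)" by blast
  let ?q = "(f ^^ i) p"
  \<comment> \<open>Between \<open>y\<close> and \<open>z\<close>, \<open>?g\<close> moves points
    left and could not lift \<open>?q\<close> to \<open>z\<close> or above.\<close>
  have "?q \<le> y" using g_less[of ?q] i by force
  then obtain s where s: "s \<in> {?q..y}" "?g s = z"
    using interval_value[OF g, of ?q y z] i ffy order vz by auto
  from last_root[OF g s(1,2)] obtain d
    where d: "d \<in> {s..y}" "?g d = z" "\<And>t. d < t \<Longrightarrow> t \<le> y \<Longrightarrow> ?g t \<noteq> z"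
    by blast
  have "p \<le> d" using min[of i] s(1) d(1) by auto
  have "d \<noteq> y" using d(2) ffy order vz by auto
  with d(1) have dy: "d < y" by simp
  have g_less_z: "?g t < z" if "d < t" "t < z" for t
  proof (cases "t \<le> y")
    case True
    show ?thesis
    proof (rule ccontr)
      assume "\<not> ?g t < z"
      then obtain s where "s \<in> {t..y}" "?g s = z"
        using interval_value[OF g, of t y z] True ffy order vz by auto
      with d(3)[of s] that show False by auto
    qed
  qed (use g_less that in force)
  have f_gt: "z < f t" if t: "d < t" "t < z" for t
  proof (rule ccontr)
    assume *: "\<not> z < f t"
    \<comment> \<open>Since \<open>f v = b > z\<close>, a value at most \<open>z\<close> would force
      the value \<open>z\<close> at some \<open>s\<close> inside; but then
      \<open>?g s = f z \<ge> z\<close>, contradicting \<open>g_less_z\<close>.\<close>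
    have "\<exists>s. d < s \<and> s < z \<and> f s = z"
    proof (cases "t \<le> v")
      case True
      then obtain s where "s \<in> {t..v}" "f s = z"
        using interval_value[OF cont, of t v z] * fv zb by auto
      with t vz show ?thesis by (intro exI[of _ s]) auto
    next
      case False
      then obtain s where "s \<in> {v..t}" "f s = z"
        using interval_value[OF cont, of v t z] * fv zb by auto
      with t dy order show ?thesis by (intro exI[of _ s]) auto
    qed
    with f_ne g_less_z show False by blast
  qed
  \<comment> \<open>The horseshoe comes from \<open>?g d = z\<close>,
    \<open>?g v = p \<le> d\<close> and \<open>?g z = z\<close>.\<close>
  obtain x where x: "least_period ?g n x" "\<And>i. (?g ^^ i) x \<in> {d..z}"
    using horseshoe_cases[OF g \<open>0 < n\<close>, of d v z] d dy order vz z(2) fv fb \<open>p \<le> d\<close> by auto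
  have gpow: "?g ^^ i = f ^^ (2 * i)" for i
    using funpow_mult[where f = f and m = 2 and n = i] by (simp add: eval_nat_numeral o_def)
  \<comment> \<open>As \<open>n > 1\<close>, the orbit avoids the fixed point \<open>z\<close> of
    \<open>?g\<close>, hence also \<open>d\<close>, which is sent to \<open>z\<close>.\<close>
  have inside: "(?g ^^ i) x \<in> {d<..<z}" for i
  proof -
    have moving: "?g ((?g ^^ j) x) \<noteq> (?g ^^ j) x" for j
      using least_periodD(3)[OF least_period_funpow[OF x(1), of j], of 1] False by simp
    from moving[of i] z(2) have "(?g ^^ i) x \<noteq> z" by auto
    moreover from moving[of "Suc i"] z(2) d(2) have "(?g ^^ i) x \<noteq> d" by auto
    ultimately show ?thesis using x(2)[of i] by auto
  qed
  have odd_ne: "(f ^^ (2 * i + 1)) x \<noteq> x" for i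
  proof -
    have "(f ^^ (2 * i + 1)) x = f ((?g ^^ i) x)" by (simp add: gpow)
    with f_gt[of "(?g ^^ i) x"] inside[of i] inside[of 0] show ?thesis by simp
  qed
  have "least_period f (2 * n) x"
    unfolding least_period_def
  proof (intro conjI allI)
    fix k
    show "(f ^^ k) x = x \<longleftrightarrow> 2 * n dvd k"
    proof (cases "even k")
      case True
      then obtain j where "k = 2 * j" by blast
      thus ?thesis using least_periodD(3)[OF x(1), of j] gpow[of j] by simp
    next
      case False
      thus ?thesis using odd_ne by (metis dvd_mult_left oddE)
    qed
  qed (use \<open>0 < n\<close> in simp)
  thus ?thesis by blast
qed

end

section \<open>From single maps to the full ordering\<close>

lemma period_two:
  fixes f :: "real \<Rightarrow> real"
  assumes "continuous_on UNIV f" "least_period f m x" "3 \<le> m"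
  shows "\<exists>x. least_period f 2 x"
  using orbit_cases[OF assms]
proof (elim disjE exE)
  fix p v b y assume "orbit_without_fixpoint f p v b y m"
  thus ?thesis by (blast dest: orbit_without_fixpoint.least_period_y)
qed simp

lemma odd_periods:
  fixes f :: "real \<Rightarrow> real"
  assumes f: "continuous_on UNIV f" and x: "least_period f m x"
    and m: "odd m" "3 \<le> m" and q: "odd q" "m \<le> q"
  shows "\<exists>x. least_period f q x"
proof -
  have *: "\<exists>x. least_period f (m + 2 * j) x" for j
  proof (induction j)
    case (Suc j)
    then obtain y where y: "least_period f (m + 2 * j) y" by blast
    have "3 \<le> m + 2 * j" using m by simp
    from orbit_cases[OF f y this] show ?case
    proof (elim disjE exE)
      fix p v b y assume "orbit_without_fixpoint f p v b y (m + 2 * j)"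
      from orbit_without_fixpoint.period_add_2[OF this] m show ?thesis by simp
    qed simp_all
  qed (use x in auto)
  have "even (q - m)" using q m by simp
  then obtain j where "q - m = 2 * j" by blast
  with q have "q = m + 2 * j" by simp
  with * show ?thesis by simp
qed

lemma all_even_periods:
  fixes f :: "real \<Rightarrow> real"
  assumes "continuous_on UNIV f" "least_period f m x" "odd m" "3 \<le> m" "0 < n" "even n"
  shows "\<exists>x. least_period f n x"
proof -
  obtain k where "n = 2 * k" using \<open>even n\<close> by blast
  with \<open>0 < n\<close> have "0 < k" by simp
  from orbit_cases[OF assms(1,2,4)] show ?thesis
  proof (elim disjE exE)
    fix p v b y assume "orbit_without_fixpoint f p v b y m"
    from orbit_without_fixpoint.even_periods[OF this assms(3,4) \<open>0 < k\<close>] show ?thesis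
      unfolding \<open>n = 2 * k\<close> .
  qed (use \<open>0 < n\<close> in simp)
qed

text \<open>A 2-cycle is swapped by \<open>f\<close>, which forces a fixed point between its points;
  for \<open>m \<ge> 3\<close> the signs at \<open>v\<close> and \<open>b\<close> do.\<close>

lemma fixpoint_exists:
  fixes f :: "real \<Rightarrow> real"
  assumes f: "continuous_on UNIV f" and x: "least_period f m x" and m: "2 \<le> m"
  shows "\<exists>x. least_period f 1 x"
proof -
  have "\<exists>t. f t = t"
  proof (cases "m = 2")
    case True
    hence ffx: "f (f x) = x" using least_periodD(2)[OF x] by (simp add: eval_nat_numeral)
    show ?thesis
    proof (cases "x \<le> f x")
      case True
      from interval_fixpoint[OF f this] ffx True show ?thesis by auto
    next
      case False
      from interval_fixpoint[OF f, of "f x" x] ffx False show ?thesis by auto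
    qed
  next
    case False
    with m have "3 \<le> m" by simp
    obtain p v b where "p < v" "v < b" "f v = b" "f b = p"
      by (rule orbit_configuration[OF f x \<open>3 \<le> m\<close>])
    with interval_fixpoint[OF f, of v b] show ?thesis by auto
  qed
  then obtain t where "f t = t" by blast
  hence "least_period f 1 t" by (intro least_periodI) auto
  thus ?thesis by blast
qed

text \<open>\<open>f ^^ (2 ^ i)\<close> has least period \<open>2 * k \<ge> 3\<close> at
  \<open>x\<close>, hence a point of period 2. As 2 is even, no factor is lost on returning to
  \<open>f\<close>.\<close>

lemma power_two_period:
  fixes f :: "real \<Rightarrow> real"
  assumes f: "continuous_on UNIV f" and x: "least_period f (2 ^ Suc i * k) x" and k: "2 \<le> k"
  shows "\<exists>x. least_period f (2 ^ Suc i) x"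
proof -
  have "2 ^ Suc i * k = 2 ^ i * (2 * k)" by simp
  with x have "least_period f (2 ^ i * (2 * k)) x" by metis
  hence "least_period (f ^^ (2 ^ i)) (2 * k) x" by (rule least_period_power) simp
  moreover have "3 \<le> 2 * k" using k by simp
  ultimately obtain y where "least_period (f ^^ (2 ^ i)) 2 y"
    using period_two[OF continuous_on_funpow[OF f]] by blast
  from least_period_of_power_two[OF this] show ?thesis by (auto simp: mult.commute)
qed

theorem sharkovsky_least_period:
  fixes f :: "real \<Rightarrow> real"
  assumes f: "continuous_on UNIV f" and x: "least_period f m x" and "m \<triangleright> n"
  shows "\<exists>x. least_period f n x"
proof -
  obtain a p b q where m: "m = 2 ^ a * p" "odd p" and n: "n = 2 ^ b * q" "odd q"
    and cases: "p > 1 \<and> q > 1 \<and> (a < b \<or> a = b \<and> p < q) \<or> p > 1 \<and> q = 1 \<or> p = 1 \<and> q = 1 \<and> b < a"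
    using \<open>m \<triangleright> n\<close> unfolding sharkovsky_def by blast
  let ?F = "\<lambda>i. f ^^ (2 ^ i)"
  have F: "continuous_on UNIV (?F i)" for i by (rule continuous_on_funpow[OF f])
  have Fx: "least_period (?F a) p x"
    using least_period_power[of f "2 ^ a" p x] x m by simp
  have p: "3 \<le> p" if "p > 1" using that \<open>odd p\<close> by (cases "p = 2") auto
  \<comment> \<open>The first case includes \<open>q = 1\<close>; the last collects the remaining
    powers of two, all proper divisors of \<open>m\<close>.\<close>
  consider "p > 1" "a < b" | "p > 1" "a = b" "p < q" | "q = 1" "b \<le> a" "2 ^ b < m"
  proof -
    have "(2::nat) ^ b < m" if "p > 1" "b \<le> a"
    proof -
      have "(2::nat) ^ b \<le> 2 ^ a" using that by simp
      also have "\<dots> < 2 ^ a * p" using that by simp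
      finally show ?thesis using m by simp
    qed
    moreover have "(2::nat) ^ b < m" if "p = 1" "b < a" using that m by simp
    ultimately show thesis using cases that by (metis not_le less_imp_le)
  qed
  thus ?thesis
  proof cases
    case 1
    then obtain j where j: "b = a + j" "0 < j" by (metis less_imp_add_positive)
    have even: "even (2 ^ j * q)" "0 < 2 ^ j * q" using j n by (auto simp: odd_pos)
    obtain y where "least_period (?F a) (2 ^ j * q) y"
      using all_even_periods[OF F Fx \<open>odd p\<close> p[OF 1(1)]] even by blast
    from least_period_of_power_two[OF this] even(1) show ?thesis
      by (auto simp: n j power_add mult_ac)
  next
    case 2
    obtain y where "least_period (?F a) q y"
      using odd_periods[OF F Fx \<open>odd p\<close> p[OF 2(1)] \<open>odd q\<close>] 2 by auto
    from least_period_of_power_two[OF this]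
    obtain i where i: "i \<le> a" "least_period f (2 ^ i * q) y" by blast
    show ?thesis
    proof (cases "i = a")
      case True
      with i n 2 show ?thesis by auto
    next
      \<comment> \<open>The period under \<open>f\<close> has dropped to \<open>2 ^ i * q\<close>
        with \<open>i < a\<close>. Since \<open>q\<close> is odd, the missing power of two is
        restored as an even period of \<open>?F i\<close>.\<close>
      case False
      with i obtain j where j: "a = i + j" "0 < j" by (metis le_neq_implies_less less_imp_add_positive)
      have even: "even (2 ^ j * q)" "0 < 2 ^ j * q" using j n by (auto simp: odd_pos)
      have "least_period (?F i) q y"
        using least_period_power[OF i(2)] by simp
      then obtain z where "least_period (?F i) (2 ^ j * q) z"
        using all_even_periods[OF F _ \<open>odd q\<close>] even p 2 by (meson less_imp_le le_trans)
      from least_period_of_power_two[OF this] even(1) show ?thesis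
        by (auto simp: n 2(2)[symmetric] j power_add mult_ac)
    qed
  next
    case 3
    have "2 ^ b dvd m" using 3 m by (simp add: le_imp_power_dvd)
    then obtain k where k: "m = 2 ^ b * k" by blast
    with 3 have "2 \<le> k" by (cases k; cases "k = 1") auto
    show ?thesis
    proof (cases b)
      case 0
      with fixpoint_exists[OF f x] k \<open>2 \<le> k\<close> 3 n show ?thesis by simp
    next
      case (Suc i)
      with power_two_period[OF f, of i k x] x k \<open>2 \<le> k\<close> 3 n show ?thesis by simp
    qed
  qed
qed

section \<open>Cycles of a self-map of an interval\<close>

text \<open>Cardinality \<open>n\<close> means that the first \<open>n\<close> iterates are
  distinct; a coincidence at times \<open>i < j\<close> would be a return of
  \<open>(f ^^ i) x\<close> after fewer than \<open>n\<close> steps.\<close>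

lemma is_cycle_iff_least_period:
  "(\<exists>C. is_cycle f I n C) \<longleftrightarrow> (\<exists>x\<in>I. least_period f n x)"
proof
  assume "\<exists>C. is_cycle f I n C"
  then obtain x where x: "0 < n" "x \<in> I" "card ((\<lambda>k. (f ^^ k) x) ` {..<n}) = n" "(f ^^ n) x = x"
    unfolding is_cycle_def by blast
  have "inj_on (\<lambda>k. (f ^^ k) x) {..<n}" using x(3) by (intro eq_card_imp_inj_on) auto
  hence "(f ^^ k) x \<noteq> x" if "0 < k" "k < n" for k
    using that inj_onD[of "\<lambda>k. (f ^^ k) x" "{..<n}" k 0] by auto
  with x show "\<exists>x\<in>I. least_period f n x" by (auto intro: least_periodI)
next
  assume "\<exists>x\<in>I. least_period f n x"
  then obtain x where x: "x \<in> I" "least_period f n x" by blast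
  have "inj_on (\<lambda>k. (f ^^ k) x) {..<n}"
  proof (rule linorder_inj_onI')
    fix i j assume ij: "i \<in> {..<n}" "j \<in> {..<n}" "i < j"
    have "(f ^^ (j - i)) ((f ^^ i) x) = (f ^^ j) x"
      using ij by (simp flip: funpow_add[THEN fun_cong, unfolded o_apply])
    moreover have "\<not> n dvd j - i" using ij by (auto dest!: dvd_imp_le)
    ultimately show "(f ^^ i) x \<noteq> (f ^^ j) x"
      using least_periodD(3)[OF least_period_funpow[OF x(2)]] by metis
  qed
  hence "card ((\<lambda>k. (f ^^ k) x) ` {..<n}) = n" by (simp add: card_image)
  with x show "\<exists>C. is_cycle f I n C"
    unfolding is_cycle_def using least_periodD[OF x(2)] by blast
qed

text \<open>Precomposing with the retraction onto \<open>I\<close> extends \<open>f\<close> continuously to the whole line without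
  creating new periodic points.\<close>

theorem theorem10:
  fixes f :: "real \<Rightarrow> real" and a b :: real and I :: "real set" and m m' :: nat
  assumes "a \<le> b" and "I = {a..b}"
    and "continuous_on I f" and "f \<in> I \<rightarrow> I"
    and "\<exists>C. is_cycle f I m C"
    and "m \<triangleright> m'"
  shows "\<exists>C. is_cycle f I m' C"
proof -
  define r where "r x = max a (min b x)" for x
  define F where "F = f \<circ> r"
  have r: "r x \<in> I" "x \<in> I \<Longrightarrow> r x = x" for x
    using assms(1,2) by (auto simp: r_def)
  have "continuous_on UNIV r" unfolding r_def by (intro continuous_intros)
  hence F: "continuous_on UNIV F"
    unfolding F_def using r assms(3)
    by (intro continuous_on_compose) (auto intro: continuous_on_subset)
  have F_in: "F x \<in> I" for x using r(1)[of x] assms(4) by (auto simp: F_def)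
  have agree: "(F ^^ k) x = (f ^^ k) x \<and> (f ^^ k) x \<in> I" if "x \<in> I" for k x
    by (induction k) (use that assms(4) r in \<open>auto simp: F_def\<close>)
  hence period: "least_period F n x \<longleftrightarrow> least_period f n x" if "x \<in> I" for n x
    using that by (auto simp: least_period_def)
  obtain x where "x \<in> I" "least_period f m x"
    using assms(5) is_cycle_iff_least_period[of f I m] by blast
  with period obtain y where y: "least_period F m' y"
    using sharkovsky_least_period[OF F _ assms(6)] by blast
  \<comment> \<open>A priori \<open>y\<close> is any real number; as a periodic point it is a value
    of \<open>F\<close>, so it lies in \<open>I\<close>.\<close>
  have "(F ^^ m') y = F ((F ^^ (m' - 1)) y)"
    using least_periodD(1)[OF y] by (cases m') auto
  with F_in least_periodD(2)[OF y] have "y \<in> I" by metis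
  with y period show ?thesis
    using is_cycle_iff_least_period[of f I m'] by blast
qed

end
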